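(* Let $p$ be an odd prime and let $G$ be a finite $p$-group with the property that every normal abelian subgroup of $G$ is cyclic. Then $G$ is cyclic. *)

theory Defs
  imports "HOL-Algebra.Algebra" "HOL-Computational_Algebra.Primes"
begin

(* The exponent n may be 0, so the trivial group is a p-group for every p. *)
definition finite_p_group :: "nat \<Rightarrow> ('a, 'b) monoid_scheme \<Rightarrow> bool"
  where "finite_p_group p G \<longleftrightarrow>
    group G \<and> finite (carrier G) \<and> (\<exists>n::nat. order G = p ^ n)"

end

theory Submission
  imports Defs "HOL-Number_Theory.Residues"
begin

text \<open>
  Let \<open>A = \<langle>a\<rangle>\<close> be a maximal normal abelian subgroup of \<open>G\<close> and suppose that it is proper.  The
  quotient of \<open>G\<close> by \<open>A\<close> is a nontrivial \<open>p\<close>-group, so its centre has an element of order \<open>p\<close>;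
  lift it to \<open>x\<close> (\<open>p_group_central_element_mod_normal\<close>).  Adjoining to a normal abelian subgroup
  an element that centralizes it and is central modulo it gives a larger normal abelian subgroup
  (\<open>normal_abelian_extension\<close>), so by maximality \<open>x\<close> does not commute with \<open>a\<close>.

  Write \<open>x a = a [^] r x\<close>.  As \<open>x [^] p\<close> lies in \<open>A\<close>, it commutes with \<open>a\<close>, so \<open>r ^ p\<close> is 1
  modulo the order of \<open>a\<close>, and \<open>r\<close> is 1 modulo \<open>p\<close> by Fermat's little theorem.  For \<open>d\<close> in \<open>A\<close>
  one has \<open>(d x) [^] p = d [^] S x [^] p\<close> with \<open>S = 1 + r + \<dots> + r ^ (p - 1)\<close>.  This is where
  \<open>p\<close> must be odd: for odd \<open>p\<close> the number \<open>S\<close> is \<open>p\<close> times a number prime to \<open>p\<close>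
  (\<open>sum_powers_cong_one\<close>), whereas for \<open>p = 2\<close> and \<open>r = 3\<close> it is 4.  (The generalized
  quaternion groups show that the theorem itself fails for \<open>p = 2\<close>.)  Up to units modulo the
  order of \<open>a\<close>, taking \<open>p\<close>-th powers in the coset \<open>A x\<close> is therefore as simple as in an abelian
  group, and two things follow: the coset contains an element \<open>y\<close> with \<open>y [^] p = \<one>\<close>
  (\<open>order_p_in_coset_of_cyclic\<close>), and the elements of \<open>A y\<close> whose \<open>p\<close>-th power is \<open>\<one>\<close> are
  exactly those of \<open>Z y\<close>, where \<open>Z\<close> is the subgroup of all \<open>d\<close> in \<open>A\<close> with \<open>d [^] p = \<one>\<close>.

  A conjugate of \<open>y\<close> lies in \<open>A y\<close> and has trivial \<open>p\<close>-th power, hence lies in \<open>Z y\<close>; and \<open>y\<close>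
  centralizes \<open>Z\<close> because \<open>r\<close> is 1 modulo \<open>p\<close>.  So \<open>Z\<langle>y\<rangle>\<close> is a normal abelian subgroup, again by
  \<open>normal_abelian_extension\<close>.  It is elementary abelian and strictly larger than the nontrivial
  group \<open>Z\<close>, so it is not cyclic (\<open>elementary_extension_not_cyclic\<close>).  A group whose normal
  abelian subgroups are all cyclic must therefore be equal to \<open>A\<close>.
\<close>

section \<open>Sums of powers modulo the square of an odd prime\<close>

text \<open>
  Writing \<open>r = 1 + p t\<close>, the sum is \<open>p + p t (p (p - 1) / 2)\<close> modulo \<open>p\<^sup>2\<close>, and the second summand
  vanishes because \<open>(p - 1) / 2\<close> is an integer.
\<close>

lemma sum_powers_cong_one:
  fixes p r :: nat
  assumes "Factorial_Ring.prime p" "odd p" "[r = 1] (mod p)"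
  shows "\<exists>s. (\<Sum>i<p. r ^ i) = p * s \<and> coprime s p"
proof -
  have p1: "p > 1" using assms(1) prime_gt_1_nat by blast
  have "r mod p = 1" using assms(3) p1 by (simp add: cong_def)
  then obtain t where r: "r = 1 + p * t"
    by (metis add.commute div_mult_mod_eq mult.commute)
  have pow: "[r ^ i = 1 + i * p * t] (mod p * p)" for i
  proof (induction i)
    case (Suc i)
    have "[r * r ^ i = (1 + p * t) * (1 + i * p * t)] (mod p * p)"
      using cong_mult[OF cong_refl Suc, of r] r by simp
    also have "(1 + p * t) * (1 + i * p * t) = (1 + Suc i * p * t) + (p * p) * (i * t * t)"
      by (simp add: algebra_simps)
    also have "[\<dots> = 1 + Suc i * p * t] (mod p * p)"
      by (simp add: cong_def)
    finally show ?case by simp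
  qed simp
  obtain h where h: "p = 2 * h + 1" using assms(2) by (auto elim: oddE)
  have "[(\<Sum>i<p. r ^ i) = (\<Sum>i<p. 1 + i * p * t)] (mod p * p)"
    using pow by (intro cong_sum) auto
  also have "(\<Sum>i<p. 1 + i * p * t) = p + (\<Sum>i<p. i) * p * t"
    by (simp only: sum.distrib sum_distrib_right) simp
  also have "(\<Sum>i<p. i) = p * h"
    using gauss_sum_nat[of "p - 1"] h by (simp add: lessThan_Suc_atMost atLeast0AtMost)
  also have "[p + p * h * p * t = p] (mod p * p)"
    by (metis (no_types, opaque_lifting) cong_add_lcancel_0_nat cong_mult_self_left mult.assoc mult.commute cong_0_iff dvd_triv_left)
  finally have S: "[(\<Sum>i<p. r ^ i) = p] (mod p * p)" .
  have "p dvd (\<Sum>i<p. r ^ i)"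
    using cong_dvd_iff[OF cong_dvd_modulus_nat[OF S, of p]] by simp
  then obtain s where s: "(\<Sum>i<p. r ^ i) = p * s" by blast
  have "[p * s = p * 1] (mod p * p)" using S s by simp
  hence "[s = 1] (mod p)"
    using p1 unfolding cong_def by (simp only: mult_mod_right[symmetric]) simp
  hence "coprime s p"
    by (metis cong_imp_coprime cong_sym coprime_1_left)
  with s show ?thesis by blast
qed

section \<open>Products with an element that normalizes a cyclic subgroup\<close>

context group
begin

lemma pow_cong_ord:
  fixes m n :: nat
  assumes "a \<in> carrier G" "[m = n] (mod ord a)"
  shows "a [^] m = a [^] n"
proof -
  have "int (ord a) dvd int n - int m"
    using assms(2) by (metis cong_iff_dvd_diff cong_int_iff cong_sym)
  hence "a [^] int m = a [^] int n" using assms(1) by (simp add: int_pow_eq)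
  thus ?thesis by (simp add: int_pow_int)
qed

lemma pow_coprime_generates:
  fixes m :: nat
  assumes "a \<in> carrier G" "coprime m (ord a)"
  shows "\<exists>s::nat. (a [^] m) [^] s = a"
proof -
  obtain s where "[m * s = Suc 0] (mod ord a)"
    using cong_solve_coprime_nat[OF assms(2)] by blast
  hence "a [^] (m * s) = a [^] Suc 0" by (rule pow_cong_ord[OF assms(1)])
  thus ?thesis using assms(1) by (auto simp: nat_pow_pow)
qed

lemma twisted_commute_pow:
  assumes "x \<in> carrier G" "d \<in> carrier G" "e \<in> carrier G" "x \<otimes> d = e \<otimes> x"
  shows "x \<otimes> d [^] (m::nat) = e [^] m \<otimes> x"
proof (induction m)
  case (Suc m)
  have "x \<otimes> d [^] Suc m = (x \<otimes> d [^] m) \<otimes> d" using assms by (simp add: m_assoc)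
  also have "\<dots> = e [^] m \<otimes> (x \<otimes> d)" using assms Suc by (simp add: m_assoc)
  also have "\<dots> = e [^] Suc m \<otimes> x" using assms by (simp add: m_assoc)
  finally show ?case .
qed (use assms in simp)

lemma pow_twisted_commute:
  fixes r k :: nat
  assumes "x \<in> carrier G" "d \<in> carrier G" "x \<otimes> d = d [^] r \<otimes> x"
  shows "x [^] k \<otimes> d = d [^] (r ^ k) \<otimes> x [^] k"
proof (induction k)
  case (Suc k)
  have "x [^] Suc k \<otimes> d = x \<otimes> (x [^] k \<otimes> d)"
    using nat_pow_Suc2[OF assms(1), of k] assms(1,2) by (simp add: m_assoc del: nat_pow_Suc)
  also have "\<dots> = (x \<otimes> d [^] (r ^ k)) \<otimes> x [^] k" using assms Suc by (simp add: m_assoc)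
  also have "\<dots> = (d [^] (r * r ^ k) \<otimes> x) \<otimes> x [^] k"
    using twisted_commute_pow[OF assms(1,2) _ assms(3)] assms by (simp add: nat_pow_pow)
  also have "\<dots> = d [^] (r ^ Suc k) \<otimes> x [^] Suc k"
    using nat_pow_Suc2[OF assms(1), of k] assms(1,2) by (simp add: m_assoc del: nat_pow_Suc)
  finally show ?case .
qed (use assms in simp)

text \<open>Moving all factors \<open>x\<close> to the right raises the \<open>i\<close>-th factor \<open>d\<close>, counted from 0, to \<open>r ^ i\<close>.\<close>

lemma twisted_product_pow:
  fixes r k :: nat
  assumes "x \<in> carrier G" "d \<in> carrier G" "x \<otimes> d = d [^] r \<otimes> x"
  shows "(d \<otimes> x) [^] k = d [^] (\<Sum>i<k. r ^ i) \<otimes> x [^] k"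
proof (induction k)
  case (Suc k)
  have "(d \<otimes> x) [^] Suc k = d [^] (\<Sum>i<k. r ^ i) \<otimes> (x [^] k \<otimes> d) \<otimes> x"
    using assms Suc by (simp add: m_assoc)
  also have "\<dots> = (d [^] (\<Sum>i<k. r ^ i) \<otimes> d [^] (r ^ k)) \<otimes> x [^] Suc k"
    using assms pow_twisted_commute[OF assms, of k] by (simp add: m_assoc)
  finally show ?case using assms by (simp add: nat_pow_mult)
qed (use assms in simp)

text \<open>
  Conjugating \<open>a\<close> by \<open>x [^] p\<close> yields \<open>r ^ p = 1\<close> modulo the order of \<open>a\<close>, hence modulo \<open>p\<close>, and
  \<open>r ^ p = r\<close> modulo \<open>p\<close> by Fermat's little theorem.
\<close>

lemma twisted_exponent_cong_one:
  fixes p r n :: nat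
  assumes p: "Factorial_Ring.prime p"
    and a: "a \<in> carrier G" "a \<noteq> \<one>" "ord a = p ^ n"
    and x: "x \<in> carrier G" "x \<otimes> a = a [^] r \<otimes> x" "x [^] p \<otimes> a = a \<otimes> x [^] p"
  shows "[r = 1] (mod p)"
proof -
  have "p dvd ord a"
    using a ord_eq_1 p by (cases n) auto
  have "a [^] (r ^ p) \<otimes> x [^] p = a \<otimes> x [^] p"
    using pow_twisted_commute[OF x(1) a(1) x(2), of p] x(3) by simp
  hence "a [^] (r ^ p) = a" using a x by simp
  hence "a [^] int (r ^ p) = a [^] int 1" using a by (simp only: int_pow_int) simp
  hence "int (ord a) dvd int 1 - int (r ^ p)" using int_pow_eq a(1) by blast
  hence "int p dvd int 1 - int (r ^ p)"
    using \<open>p dvd ord a\<close> by (meson dvd_trans int_dvd_int_iff)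
  hence rp: "[r ^ p = 1] (mod p)"
    by (metis cong_iff_dvd_diff cong_int_iff cong_sym)
  have ndvd: "\<not> p dvd r"
  proof
    assume "p dvd r"
    hence "p dvd r ^ p" using p prime_gt_0_nat by (metis dvd_power dvd_trans)
    hence "p dvd 1" using cong_dvd_iff[OF rp] by simp
    thus False using p by simp
  qed
  have "[r * r ^ (p - 1) = r * 1] (mod p)"
    using fermat_theorem[OF p ndvd] by (rule cong_scalar_left)
  moreover have "r * r ^ (p - 1) = r ^ p"
    using p prime_gt_0_nat by (metis power_eq_if not_gr0)
  ultimately show ?thesis using rp by (metis cong_sym cong_trans mult_1_right)
qed

text \<open>
  The twisted sum of powers does not change when \<open>a\<close> is replaced by \<open>a [^] k\<close>, so one \<open>s\<close> serves
  all of the coset.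
\<close>

lemma power_in_coset_of_cyclic:
  fixes p r n :: nat
  assumes p: "Factorial_Ring.prime p" "odd p"
    and a: "a \<in> carrier G" "a \<noteq> \<one>" "ord a = p ^ n"
    and x: "x \<in> carrier G" "x \<otimes> a = a [^] r \<otimes> x" "x [^] p \<otimes> a = a \<otimes> x [^] p"
  shows "\<exists>s. coprime s p \<and> (\<forall>k::nat. (a [^] k \<otimes> x) [^] p = a [^] (k * (p * s)) \<otimes> x [^] p)"
proof -
  obtain s where s: "(\<Sum>i<p. r ^ i) = p * s" "coprime s p"
    using sum_powers_cong_one[OF p twisted_exponent_cong_one[OF p(1) a x]] by blast
  have "(a [^] k \<otimes> x) [^] p = a [^] (k * (p * s)) \<otimes> x [^] p" for k :: nat
  proof -
    have "x \<otimes> a [^] k = (a [^] k) [^] r \<otimes> x"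
      using twisted_commute_pow[OF x(1) a(1) _ x(2)] a by (simp add: nat_pow_pow mult.commute)
    thus ?thesis using twisted_product_pow[of x "a [^] k" r p] a x s by (simp add: nat_pow_pow)
  qed
  with s show ?thesis by blast
qed

text \<open>
  If \<open>p\<close> did not divide \<open>m\<close>, then \<open>x [^] p\<close> would generate \<open>\<langle>a\<rangle>\<close>, so \<open>x\<close> would commute with
  \<open>a\<close>.  Hence \<open>x [^] p\<close> is itself a \<open>p\<close>-th power in \<open>\<langle>a\<rangle>\<close>, and the formula for \<open>p\<close>-th powers
  in the coset \<open>\<langle>a\<rangle> x\<close> lets one cancel it.
\<close>

lemma order_p_in_coset_of_cyclic:
  fixes p r n m :: nat
  assumes p: "Factorial_Ring.prime p" "odd p"
    and a: "a \<in> carrier G" "a \<noteq> \<one>" "ord a = p ^ n"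
    and x: "x \<in> carrier G" "x \<otimes> a = a [^] r \<otimes> x" "x [^] p = a [^] m"
    and xa: "x \<otimes> a \<noteq> a \<otimes> x"
  shows "\<exists>k::nat. (a [^] k \<otimes> x) [^] p = \<one>"
proof -
  have "x [^] p \<otimes> a = a \<otimes> x [^] p"
    using x(3) a(1) by (metis nat_pow_comm nat_pow_eone)
  then obtain s where s: "coprime s p"
      "\<And>k::nat. (a [^] k \<otimes> x) [^] p = a [^] (k * (p * s)) \<otimes> x [^] p"
    using power_in_coset_of_cyclic[OF p a x(1,2)] by blast
  have "p dvd m"
  proof (rule ccontr)
    assume "\<not> p dvd m"
    hence "coprime m (ord a)"
      using p(1) a(3) by (metis coprime_commute coprime_power_right_iff prime_imp_coprime)
    then obtain t :: nat where "(a [^] m) [^] t = a"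
      using pow_coprime_generates a(1) by blast
    hence "x [^] (p * t) = a" using x(1,3) by (metis nat_pow_pow)
    thus False using x(1) xa by (metis nat_pow_comm nat_pow_eone)
  qed
  then obtain j where j: "m = p * j" by blast
  have N: "ord a > 0" using a(3) p(1) prime_gt_0_nat by simp
  have "coprime s (ord a)" using s(1) a(3) by simp
  then obtain t where t: "[s * t = 1] (mod ord a)"
    using cong_solve_coprime_nat by (metis One_nat_def)
  \<comment> \<open>This \<open>k\<close> is congruent to \<open>- j / s\<close> modulo the order of \<open>a\<close>; the factor \<open>ord a - 1\<close>
    stands for \<open>- 1\<close> in the natural numbers.\<close>
  define k where "k = t * (j * (ord a - 1))"
  have "k * (p * s) = (s * t) * (p * j * (ord a - 1))" by (simp add: k_def mult_ac)
  hence "[k * (p * s) = 1 * (p * j * (ord a - 1))] (mod ord a)"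
    using cong_mult[OF t cong_refl] by metis
  hence "[k * (p * s) + m = p * j * (ord a - 1) + m] (mod ord a)"
    by (simp add: cong_add_rcancel_nat)
  moreover have "p * j * (ord a - 1) + m = p * j * ord a"
    using N j by (cases "ord a") auto
  ultimately have "[k * (p * s) + m = 0] (mod ord a)" by (simp add: cong_def)
  hence "a [^] (k * (p * s) + m) = \<one>" using pow_cong_ord[OF a(1)] by fastforce
  hence "(a [^] k \<otimes> x) [^] p = \<one>" using s(2) x(1,3) a(1) by (simp add: nat_pow_mult)
  thus ?thesis by blast
qed

section \<open>Normal abelian subgroups\<close>

lemma conjugation_endomorphism:
  assumes "g \<in> carrier G"
  shows "group_hom G G (\<lambda>h. g \<otimes> h \<otimes> inv g)"
proof (intro group_hom.intro group_hom_axioms.intro homI)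
  fix x y assume xy: "x \<in> carrier G" "y \<in> carrier G"
  have "inv g \<otimes> (g \<otimes> (y \<otimes> inv g)) = y \<otimes> inv g"
    using xy assms by (simp add: m_assoc[symmetric])
  thus "g \<otimes> (x \<otimes> y) \<otimes> inv g = (g \<otimes> x \<otimes> inv g) \<otimes> (g \<otimes> y \<otimes> inv g)"
    using xy assms by (simp add: m_assoc)
qed (use assms in auto)

lemma comm_subgroup_iff:
  assumes "subgroup N G"
  shows "comm_group (G\<lparr>carrier := N\<rparr>) \<longleftrightarrow> (\<forall>x\<in>N. \<forall>y\<in>N. x \<otimes> y = y \<otimes> x)"
proof
  assume "comm_group (G\<lparr>carrier := N\<rparr>)"
  then interpret N: comm_group "G\<lparr>carrier := N\<rparr>" .
  show "\<forall>x\<in>N. \<forall>y\<in>N. x \<otimes> y = y \<otimes> x" using N.m_comm by simp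
next
  assume "\<forall>x\<in>N. \<forall>y\<in>N. x \<otimes> y = y \<otimes> x"
  thus "comm_group (G\<lparr>carrier := N\<rparr>)"
    using group.group_comm_groupI[OF subgroup_imp_group[OF assms]] by simp
qed

lemma cyclic_subgroup_generator:
  assumes "finite (carrier G)" "subgroup N G" "cyclic_group (G\<lparr>carrier := N\<rparr>)"
  shows "\<exists>w\<in>N. N = range (\<lambda>k::nat. w [^] k)"
proof -
  interpret N: group "G\<lparr>carrier := N\<rparr>" using subgroup_imp_group[OF assms(2)] .
  obtain w where w: "w \<in> N" "N = range (\<lambda>k::int. w [^]\<^bsub>G\<lparr>carrier := N\<rparr>\<^esub> k)"
    using assms(3) N.cyclic_group by auto
  have "w \<in> carrier G" using subgroup.mem_carrier[OF assms(2) w(1)] .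
  have "N = generate G {w}"
    unfolding generate_pow[OF \<open>w \<in> carrier G\<close>]
    by (subst w(2)) (auto simp: int_pow_consistent[OF assms(2) w(1)])
  also have "\<dots> = range (\<lambda>k::nat. w [^] k)"
    using generate_pow_on_finite_carrier[OF assms(1) \<open>w \<in> carrier G\<close>] by auto
  finally show ?thesis using w(1) by blast
qed

lemma mem_set_mult_generate:
  assumes "x \<in> carrier G"
  shows "b \<in> N <#> generate G {x} \<longleftrightarrow> (\<exists>n\<in>N. \<exists>k::int. b = n \<otimes> x [^] k)"
  unfolding set_mult_def generate_pow[OF assms] by blast

text \<open>
  The last hypothesis says that \<open>x\<close> is central modulo \<open>N\<close>: conjugation by \<open>g\<close> then moves the powers
  of \<open>x\<close> within \<open>N\<langle>x\<rangle>\<close>.  The lemma serves twice, to see that \<open>x\<close> cannot centralize a maximal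
  normal abelian subgroup and to build the noncyclic subgroup.
\<close>

lemma normal_abelian_extension:
  assumes N: "N \<lhd> G" "comm_group (G\<lparr>carrier := N\<rparr>)"
    and x: "x \<in> carrier G" "\<And>n. n \<in> N \<Longrightarrow> x \<otimes> n = n \<otimes> x"
    and conj: "\<And>g. g \<in> carrier G \<Longrightarrow> \<exists>n\<in>N. g \<otimes> x \<otimes> inv g = n \<otimes> x"
  shows "N <#> generate G {x} \<lhd> G"
    and "comm_group (G\<lparr>carrier := N <#> generate G {x}\<rparr>)"
    and "N \<subseteq> N <#> generate G {x}"
    and "x \<in> N <#> generate G {x}"
proof -
  let ?M = "N <#> generate G {x}"
  interpret N: normal N G by fact
  interpret second_isomorphism_grp N G "generate G {x}"
    using generate_is_subgroup[of "{x}"] x(1)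
    by (auto intro!: second_isomorphism_grp.intro second_isomorphism_grp_axioms.intro N(1))
  note mem = mem_set_mult_generate[OF x(1)]
  have M: "subgroup ?M G" by (rule normal_set_mult_subgroup)
  show sub: "N \<subseteq> ?M"
  proof
    fix n assume "n \<in> N"
    moreover have "n = n \<otimes> x [^] (0::int)" using \<open>n \<in> N\<close> by simp
    ultimately show "n \<in> ?M" using mem by blast
  qed
  have "x = \<one> \<otimes> x [^] (1::int)" using x by simp
  thus "x \<in> ?M" using mem N.one_closed by blast
  then have NxM: "n \<otimes> x \<in> ?M" if "n \<in> N" for n
    using that sub M by (meson subgroup.m_closed subsetD)
  show "?M \<lhd> G"
    unfolding normal_inv_iff
  proof (intro conjI ballI M)
    fix g b assume g: "g \<in> carrier G" and b: "b \<in> ?M"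
    obtain n and k :: int where nk: "n \<in> N" "b = n \<otimes> x [^] k" using b mem by blast
    interpret c: group_hom G G "\<lambda>h. g \<otimes> h \<otimes> inv g" by (rule conjugation_endomorphism[OF g])
    have nG: "n \<in> carrier G" using nk by simp
    have "g \<otimes> b \<otimes> inv g = (g \<otimes> n \<otimes> inv g) \<otimes> (g \<otimes> x \<otimes> inv g) [^] k"
      using c.hom_mult[of n "x [^] k"] c.hom_int_pow[OF x(1), of k] nk nG x(1) by simp
    moreover have "g \<otimes> n \<otimes> inv g \<in> ?M" using N.inv_op_closed2[OF g nk(1)] sub by blast
    moreover have "g \<otimes> x \<otimes> inv g \<in> ?M" using conj[OF g] NxM by auto
    hence "(g \<otimes> x \<otimes> inv g) [^] k \<in> ?M" by (rule subgroup_int_pow_closed[OF M])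
    ultimately show "g \<otimes> b \<otimes> inv g \<in> ?M" using M by (simp add: subgroup.m_closed)
  qed
  have Ncomm: "n \<otimes> n' = n' \<otimes> n" if "n \<in> N" "n' \<in> N" for n n'
    using N(2) comm_subgroup_iff[OF N.is_subgroup] that by blast
  have xkn: "x [^] (k::int) \<otimes> n = n \<otimes> x [^] k" if n: "n \<in> N" for k n
  proof -
    interpret c: group_hom G G "\<lambda>h. n \<otimes> h \<otimes> inv n"
      by (rule conjugation_endomorphism) (use n in simp)
    have "n \<otimes> x \<otimes> inv n = x"
      using x(2)[OF n] n x(1) by (metis N.mem_carrier inv_solve_right' m_closed)
    hence "n \<otimes> x [^] k \<otimes> inv n = x [^] k" using c.hom_int_pow[OF x(1), of k] by simp
    thus ?thesis using n x(1) by (metis N.mem_carrier inv_solve_right' int_pow_closed m_closed)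
  qed
  show "comm_group (G\<lparr>carrier := ?M\<rparr>)"
    unfolding comm_subgroup_iff[OF M]
  proof (intro ballI)
    fix b c assume "b \<in> ?M" "c \<in> ?M"
    then obtain n n' and k k' :: int where
      nk: "n \<in> N" "b = n \<otimes> x [^] k" "n' \<in> N" "c = n' \<otimes> x [^] k'"
      unfolding mem by blast
    have [simp]: "n \<in> carrier G" "n' \<in> carrier G" by (rule N.mem_carrier; rule nk)+
    have "b \<otimes> c = n \<otimes> (x [^] k \<otimes> n') \<otimes> x [^] k'" unfolding nk(2,4) using x(1) by (simp add: m_assoc)
    also have "\<dots> = (n \<otimes> n') \<otimes> (x [^] k \<otimes> x [^] k')" using xkn[OF nk(3)] x(1) by (simp add: m_assoc)
    also have "\<dots> = (n' \<otimes> n) \<otimes> (x [^] k' \<otimes> x [^] k)"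
      using Ncomm[OF nk(1,3)] x(1) by (simp add: int_pow_mult[symmetric] add.commute)
    also have "\<dots> = n' \<otimes> (x [^] k' \<otimes> n) \<otimes> x [^] k" using xkn[OF nk(1)] x(1) by (simp add: m_assoc)
    also have "\<dots> = c \<otimes> b" unfolding nk(2,4) using x(1) by (simp add: m_assoc)
    finally show "b \<otimes> c = c \<otimes> b" .
  qed
qed

text \<open>Commutativity of \<open>N\<close> makes the \<open>p\<close>-torsion closed under products.\<close>

lemma normal_abelian_torsion:
  fixes p :: nat
  assumes N: "N \<lhd> G" "comm_group (G\<lparr>carrier := N\<rparr>)"
  shows "{d \<in> N. d [^] p = \<one>} \<lhd> G"
    and "comm_group (G\<lparr>carrier := {d \<in> N. d [^] p = \<one>}\<rparr>)"
proof -
  let ?Z = "{d \<in> N. d [^] p = \<one>}"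
  interpret N: normal N G by fact
  have Ncomm: "n \<otimes> n' = n' \<otimes> n" if "n \<in> N" "n' \<in> N" for n n'
    using N(2) comm_subgroup_iff[OF N.is_subgroup] that by blast
  have Z: "subgroup ?Z G"
  proof (rule subgroupI)
    have "\<one> \<in> ?Z" by simp
    thus "?Z \<noteq> {}" by blast
    fix c d assume "c \<in> ?Z" "d \<in> ?Z"
    thus "c \<otimes> d \<in> ?Z" using Ncomm[of c d] pow_mult_distrib[of c d p] by simp
  qed (auto simp: nat_pow_inv)
  show "?Z \<lhd> G"
    unfolding normal_inv_iff
  proof (intro conjI ballI Z)
    fix g d assume g: "g \<in> carrier G" and d: "d \<in> ?Z"
    interpret c: group_hom G G "\<lambda>h. g \<otimes> h \<otimes> inv g" by (rule conjugation_endomorphism[OF g])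
    have "(g \<otimes> d \<otimes> inv g) [^] p = \<one>" using c.hom_nat_pow[of d p] d g by simp
    thus "g \<otimes> d \<otimes> inv g \<in> ?Z" using N.inv_op_closed2[OF g] d by simp
  qed
  show "comm_group (G\<lparr>carrier := ?Z\<rparr>)"
    unfolding comm_subgroup_iff[OF Z]
    by (intro ballI) (rule Ncomm; simp)
qed

end

section \<open>Central elements of p-groups\<close>

lemma p_group_ord:
  assumes p: "Factorial_Ring.prime p" and G: "finite_p_group p G" and a: "a \<in> carrier G"
  shows "\<exists>n. group.ord G a = p ^ n"
proof -
  interpret group G using G by (simp add: finite_p_group_def)
  show ?thesis
    using ord_dvd_group_order[OF a] G divides_primepow_nat[OF p] by (auto simp: finite_p_group_def)
qed

text \<open>
  The class equation: the conjugacy classes have \<open>p\<close>-power size and that of \<open>\<one>\<close> is a singleton.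
  Their sizes add up to a multiple of \<open>p\<close>, so there is a further singleton class.
\<close>

lemma p_group_nontrivial_center:
  assumes p: "Factorial_Ring.prime p" and G: "finite_p_group p G" and nt: "order G \<noteq> 1"
  shows "\<exists>z\<in>carrier G. z \<noteq> \<one>\<^bsub>G\<^esub> \<and> (\<forall>g\<in>carrier G. g \<otimes>\<^bsub>G\<^esub> z = z \<otimes>\<^bsub>G\<^esub> g)"
proof (rule ccontr)
  interpret group G using G by (simp add: finite_p_group_def)
  assume contra: "\<not> ?thesis"
  have fin: "finite (carrier G)" using G by (simp add: finite_p_group_def)
  obtain n where n: "order G = p ^ n" using G by (auto simp: finite_p_group_def)
  define \<phi> where "\<phi> = (\<lambda>g. \<lambda>h\<in>carrier G. g \<otimes>\<^bsub>G\<^esub> h \<otimes>\<^bsub>G\<^esub> inv\<^bsub>G\<^esub> g)"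
  interpret act: group_action G "carrier G" \<phi>
    unfolding \<phi>_def by (rule action_by_conjugation)
  let ?O = "orbits G (carrier G) \<phi>"
  have orb1: "orbit G \<phi> \<one>\<^bsub>G\<^esub> = {\<one>\<^bsub>G\<^esub>}"
    by (auto simp: orbit_def \<phi>_def intro!: exI[of _ "\<one>\<^bsub>G\<^esub>"])
  have O1: "{\<one>\<^bsub>G\<^esub>} \<in> ?O" unfolding orbits_def using orb1 by force
  have finO: "finite ?O" using fin by (simp add: orbits_def)
  have "p dvd card B" if B: "B \<in> ?O - {{\<one>\<^bsub>G\<^esub>}}" for B
  proof -
    obtain x where x: "x \<in> carrier G" "B = orbit G \<phi> x" using B by (auto simp: orbits_def)
    have "card B dvd p ^ n" using act.orbit_stabilizer_theorem[OF x(1)] x(2) n by (metis dvd_triv_left)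
    then obtain i where i: "card B = p ^ i" using divides_primepow_nat[OF p] by blast
    have "i \<noteq> 0"
    proof
      assume "i = 0"
      hence "card B = 1" using i by simp
      moreover have "x \<in> B" using act.orbit_refl[OF x(1)] x(2) by simp
      ultimately have Bx: "B = {x}" by (metis card_1_singletonE singletonD)
      have "g \<otimes>\<^bsub>G\<^esub> x = x \<otimes>\<^bsub>G\<^esub> g" if g: "g \<in> carrier G" for g
      proof -
        have "\<phi> g x \<in> B" using x(2) g by (auto simp: orbit_def)
        hence "g \<otimes>\<^bsub>G\<^esub> x \<otimes>\<^bsub>G\<^esub> inv\<^bsub>G\<^esub> g = x" using Bx x(1) by (simp add: \<phi>_def)
        thus ?thesis using g x(1) by (metis inv_solve_right' m_closed)
      qed
      hence "x = \<one>\<^bsub>G\<^esub>" using contra x(1) by blast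
      thus False using B Bx by simp
    qed
    thus ?thesis using i by simp
  qed
  hence "p dvd (\<Sum>B\<in>?O - {{\<one>\<^bsub>G\<^esub>}}. card B)" by (rule dvd_sum)
  moreover have "order G = (\<Sum>B\<in>?O. card B)"
    using act.disjoint_sum[OF fin, of "\<lambda>_. 1::nat"] by (simp add: order_def)
  hence "order G = 1 + (\<Sum>B\<in>?O - {{\<one>\<^bsub>G\<^esub>}}. card B)"
    using sum.remove[OF finO O1, of card] by simp
  moreover have "p dvd order G" using n nt by (cases n) auto
  ultimately have "p dvd 1" using dvd_add_left_iff by metis
  thus False using p by simp
qed

lemma p_group_central_element_of_order_p:
  assumes p: "Factorial_Ring.prime p" and G: "finite_p_group p G" and nt: "order G \<noteq> 1"
  shows "\<exists>z\<in>carrier G. z \<noteq> \<one>\<^bsub>G\<^esub> \<and> z [^]\<^bsub>G\<^esub> p = \<one>\<^bsub>G\<^esub> \<and> (\<forall>g\<in>carrier G. g \<otimes>\<^bsub>G\<^esub> z = z \<otimes>\<^bsub>G\<^esub> g)"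
proof -
  interpret group G using G by (simp add: finite_p_group_def)
  obtain z where z: "z \<in> carrier G" "z \<noteq> \<one>\<^bsub>G\<^esub>" "\<And>g. g \<in> carrier G \<Longrightarrow> g \<otimes>\<^bsub>G\<^esub> z = z \<otimes>\<^bsub>G\<^esub> g"
    using p_group_nontrivial_center[OF assms] by blast
  obtain n where n: "ord z = p ^ n" using p_group_ord[OF p G z(1)] by blast
  have "n \<noteq> 0" using n z ord_eq_1 by (metis power_0)
  then obtain m where m: "n = Suc m" using not0_implies_Suc by blast
  let ?y = "z [^]\<^bsub>G\<^esub> (p ^ m)"
  have "?y [^]\<^bsub>G\<^esub> p = \<one>\<^bsub>G\<^esub>"
    using z n m by (simp add: nat_pow_pow pow_eq_id mult.commute)
  moreover have "?y \<noteq> \<one>\<^bsub>G\<^esub>"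
    using z n m p prime_gt_1_nat[OF p] by (simp add: pow_eq_id)
  moreover have "g \<otimes>\<^bsub>G\<^esub> ?y = ?y \<otimes>\<^bsub>G\<^esub> g" if "g \<in> carrier G" for g
    using group_commutes_pow[of z g "p ^ m"] z that by simp
  ultimately show ?thesis using z(1) by (meson nat_pow_closed)
qed

text \<open>
  The element is a representative of a central coset of order \<open>p\<close> in the quotient of \<open>G\<close> by \<open>N\<close>.
\<close>

lemma (in group) p_group_central_element_mod_normal:
  assumes p: "Factorial_Ring.prime p" and G: "finite_p_group p G"
    and N: "N \<lhd> G" "N \<noteq> carrier G"
  shows "\<exists>x\<in>carrier G. x \<notin> N \<and> x [^] p \<in> N \<and>
    (\<forall>g\<in>carrier G. \<exists>n\<in>N. g \<otimes> x \<otimes> inv g = n \<otimes> x)"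
proof -
  interpret normal N G by (rule N(1))
  have fin: "finite (carrier G)" using G by (simp add: finite_p_group_def)
  obtain n where n: "order G = p ^ n" using G by (auto simp: finite_p_group_def)
  define Q where Q: "Q = G Mod N"
  interpret Q: group Q unfolding Q by (rule factorgroup_is_group)
  have ordQ: "order Q * card N = order G"
    using lagrange[OF is_subgroup] by (simp add: order_def Q FactGroup_def)
  have "order Q dvd p ^ n" using ordQ n by (metis dvd_triv_left)
  then obtain i where i: "order Q = p ^ i" using divides_primepow_nat[OF p] by blast
  have "finite (carrier Q)" using fin by (simp add: Q carrier_FactGroup)
  hence Qp: "finite_p_group p Q" using i Q.is_group by (auto simp: finite_p_group_def)
  have "order Q \<noteq> 1"
  proof
    assume "order Q = 1"
    hence "card N = card (carrier G)" using ordQ by (simp add: order_def)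
    thus False using N(2) fin subset card_subset_eq by blast
  qed
  then obtain K where K: "K \<in> carrier Q" "K \<noteq> \<one>\<^bsub>Q\<^esub>" "K [^]\<^bsub>Q\<^esub> p = \<one>\<^bsub>Q\<^esub>"
      "\<And>L. L \<in> carrier Q \<Longrightarrow> L \<otimes>\<^bsub>Q\<^esub> K = K \<otimes>\<^bsub>Q\<^esub> L"
    using p_group_central_element_of_order_p[OF p Qp] by blast
  obtain x where x: "x \<in> carrier G" "K = N #> x" using K(1) by (auto simp: Q carrier_FactGroup)
  have "x \<notin> N" using K(2) x rcos_const[OF is_group] by (auto simp: Q)
  moreover have "N #> (x [^] p) = N"
    using K(3) x FactGroup_pow[OF x(1), of p] by (simp add: Q)
  hence "x [^] p \<in> N"
    using x(1) by (metis coset_join1 nat_pow_closed subset is_subgroup)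
  moreover have "\<exists>n\<in>N. g \<otimes> x \<otimes> inv g = n \<otimes> x" if g: "g \<in> carrier G" for g
  proof -
    have "N #> g \<in> carrier Q" using g by (auto simp: Q carrier_FactGroup)
    hence "N #> (g \<otimes> x) = N #> (x \<otimes> g)"
      using K(4)[of "N #> g"] x g by (simp add: Q rcos_sum)
    hence "g \<otimes> x \<in> N #> (x \<otimes> g)" using rcos_self[OF monoid.m_closed[OF is_monoid g x(1)] is_subgroup] by simp
    then obtain h where h: "h \<in> N" "g \<otimes> x = h \<otimes> (x \<otimes> g)" by (auto simp: r_coset_def)
    have "g \<otimes> x \<otimes> inv g = h \<otimes> x"
      using h g x by (simp add: m_assoc)
    thus ?thesis using h by blast
  qed
  ultimately show ?thesis using x(1) by blast
qed

section \<open>Normal abelian subgroups that are not cyclic\<close>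

context group
begin

text \<open>
  The group \<open>Z\<langle>y\<rangle>\<close> has exponent \<open>p\<close>.  If it were cyclic, any nontrivial element of \<open>Z\<close> would
  generate it, so \<open>y\<close> would lie in \<open>Z\<close>.
\<close>

lemma elementary_extension_not_cyclic:
  fixes p :: nat
  assumes p: "Factorial_Ring.prime p" and fin: "finite (carrier G)"
    and Z: "subgroup Z G" "\<And>c. c \<in> Z \<Longrightarrow> c [^] p = \<one>" "z \<in> Z" "z \<noteq> \<one>"
    and y: "y \<in> carrier G" "y [^] p = \<one>" "y \<notin> Z"
    and M: "subgroup (Z <#> generate G {y}) G"
      "comm_group (G\<lparr>carrier := Z <#> generate G {y}\<rparr>)"
      "Z \<subseteq> Z <#> generate G {y}" "y \<in> Z <#> generate G {y}"
  shows "\<not> cyclic_group (G\<lparr>carrier := Z <#> generate G {y}\<rparr>)"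
proof
  let ?M = "Z <#> generate G {y}"
  assume "cyclic_group (G\<lparr>carrier := ?M\<rparr>)"
  then obtain w where w: "w \<in> ?M" "?M = range (\<lambda>k::nat. w [^] k)"
    using cyclic_subgroup_generator[OF fin M(1)] by blast
  have wG: "w \<in> carrier G" using subgroup.mem_carrier[OF M(1) w(1)] .
  have "w [^] p = \<one>"
  proof -
    obtain c and k :: int where ck: "c \<in> Z" "w = c \<otimes> y [^] k"
      using w(1) mem_set_mult_generate[OF y(1)] by blast
    have cG: "c \<in> carrier G" using subgroup.mem_carrier[OF Z(1) ck(1)] .
    have "y [^] k \<in> ?M" using subgroup_int_pow_closed[OF M(1,4)] .
    hence "c \<otimes> y [^] k = y [^] k \<otimes> c"
      using M ck(1) comm_subgroup_iff by blast
    hence "w [^] p = c [^] p \<otimes> (y [^] k) [^] p"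
      using pow_mult_distrib ck(2) cG y(1) by simp
    also have "(y [^] k) [^] p = (y [^] p) [^] k"
      using y(1) by (simp add: int_pow_pow mult.commute flip: int_pow_int)
    finally show ?thesis using ck(1) y(2) Z(2) by simp
  qed
  hence ordw: "ord w dvd p" using wG by (simp add: pow_eq_id)
  obtain i :: nat where i: "z = w [^] i" using Z(3) M(3) w(2) by blast
  have "\<not> p dvd i" using Z(4) i wG ordw by (metis dvd_trans pow_eq_id)
  hence "coprime i (ord w)"
    using p ordw by (metis coprime_commute coprime_divisors dvd_refl prime_imp_coprime)
  then obtain t :: nat where "z [^] t = w" using pow_coprime_generates[OF wG] i by blast
  hence "w \<in> Z" using subgroup_int_pow_closed[OF Z(1,3), of "int t"] by (simp add: int_pow_int)
  moreover obtain l :: nat where "y = w [^] l" using M(4) w(2) by blast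
  ultimately have "y \<in> Z"
    using subgroup_int_pow_closed[OF Z(1), of w "int l"] by (simp add: int_pow_int)
  thus False using y(3) by blast
qed

text \<open>
  The subgroup is \<open>Z\<langle>y\<rangle>\<close>, for an element \<open>y\<close> outside \<open>A\<close> with \<open>y [^] p = \<one>\<close> that is central
  modulo \<open>A\<close>, and \<open>Z\<close> the \<open>p\<close>-torsion of \<open>A\<close>.
\<close>

lemma noncyclic_normal_abelian_subgroup:
  fixes p :: nat
  assumes p: "Factorial_Ring.prime p" "odd p" and G: "finite_p_group p G"
    and A: "A \<lhd> G" "comm_group (G\<lparr>carrier := A\<rparr>)" "cyclic_group (G\<lparr>carrier := A\<rparr>)"
    and max: "\<And>N. N \<lhd> G \<Longrightarrow> comm_group (G\<lparr>carrier := N\<rparr>) \<Longrightarrow> A \<subseteq> N \<Longrightarrow> A = N"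
    and proper: "A \<noteq> carrier G"
  shows "\<exists>M. M \<lhd> G \<and> comm_group (G\<lparr>carrier := M\<rparr>) \<and> \<not> cyclic_group (G\<lparr>carrier := M\<rparr>)"
proof -
  have fin: "finite (carrier G)" using G by (simp add: finite_p_group_def)
  interpret A: normal A G by (rule A(1))
  obtain x where x: "x \<in> carrier G" "x \<notin> A" "x [^] p \<in> A"
    "\<And>g. g \<in> carrier G \<Longrightarrow> \<exists>n\<in>A. g \<otimes> x \<otimes> inv g = n \<otimes> x"
    using p_group_central_element_mod_normal[OF p(1) G A(1) proper] by blast
  obtain a where aA: "a \<in> A" and A_eq: "A = range (\<lambda>k::nat. a [^] k)"
    using cyclic_subgroup_generator[OF fin A.is_subgroup A(3)] by blast
  have a: "a \<in> carrier G" using aA by simp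
  obtain n where n: "ord a = p ^ n" using p_group_ord[OF p(1) G a] by blast
  have xa: "x \<otimes> a \<noteq> a \<otimes> x"
  proof
    assume "x \<otimes> a = a \<otimes> x"
    hence "x \<otimes> c = c \<otimes> x" if "c \<in> A" for c
      using that A_eq twisted_commute_pow[of x a a] x(1) a by auto
    note ext = normal_abelian_extension[OF A(1,2) x(1) this x(4)]
    have "A = A <#> generate G {x}" using max ext by simp
    thus False using ext(4) x(2) by blast
  qed
  have a1: "a \<noteq> \<one>" using xa x(1) by auto
  have "x \<otimes> a \<otimes> inv x \<in> A" using A.inv_op_closed2 x(1) aA by blast
  then obtain r :: nat where "x \<otimes> a \<otimes> inv x = a [^] r" using A_eq by auto
  hence r: "x \<otimes> a = a [^] r \<otimes> x"
    using x(1) a by (metis inv_solve_right' m_closed nat_pow_closed)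
  obtain m :: nat where m: "x [^] p = a [^] m" using x(3) A_eq by auto
  obtain j :: nat where j: "(a [^] j \<otimes> x) [^] p = \<one>"
    using order_p_in_coset_of_cyclic[OF p a a1 n x(1) r m xa] by blast
  define y where "y = a [^] j \<otimes> x"
  have y: "y \<in> carrier G" using a x(1) by (simp add: y_def)
  have yp: "y [^] p = \<one>" using j by (simp add: y_def)
  have ajA: "a [^] j \<in> A" using A_eq by blast
  have yA: "y \<notin> A"
  proof
    assume "y \<in> A"
    hence "inv (a [^] j) \<otimes> y \<in> A" using ajA by blast
    thus False using x(1,2) a by (simp add: y_def m_assoc[symmetric])
  qed
  have ya: "y \<otimes> a = a [^] r \<otimes> y"
  proof -
    have "y \<otimes> a = (a [^] j \<otimes> a [^] r) \<otimes> x"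
      using a x(1) r by (simp add: y_def m_assoc)
    also have "\<dots> = (a [^] r \<otimes> a [^] j) \<otimes> x"
      using a by (simp add: nat_pow_mult add.commute)
    also have "\<dots> = a [^] r \<otimes> y"
      using a x(1) by (simp add: y_def m_assoc)
    finally show ?thesis .
  qed
  have ypa: "y [^] p \<otimes> a = a \<otimes> y [^] p" using yp a by simp
  define Z where "Z = {d \<in> A. d [^] p = \<one>}"
  have ZN: "Z \<lhd> G" "comm_group (G\<lparr>carrier := Z\<rparr>)"
    unfolding Z_def using normal_abelian_torsion[OF A(1,2)] by auto
  obtain s where s: "coprime s p"
    "\<And>k::nat. (a [^] k \<otimes> y) [^] p = a [^] (k * (p * s)) \<otimes> y [^] p"
    using power_in_coset_of_cyclic[OF p a a1 n y ya ypa] by blast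
  \<comment> \<open>Since \<open>y [^] p = \<one>\<close>, the \<open>p\<close>-th power of \<open>d \<otimes> y\<close> is that of \<open>d\<close> raised to \<open>s\<close>, and \<open>s\<close> is
    a unit modulo the order of \<open>a\<close>.\<close>
  have torsion: "d \<in> Z" if d: "d \<in> A" "(d \<otimes> y) [^] p = \<one>" for d
  proof -
    obtain k :: nat where k: "d = a [^] k" using d(1) A_eq by blast
    have "a [^] (k * (p * s)) = \<one>" using d(2) s(2)[of k] k yp a by simp
    hence "p ^ n dvd (k * p) * s" using a n by (simp add: pow_eq_id mult_ac)
    moreover have "coprime (p ^ n) s" using s(1) by (simp add: coprime_commute)
    ultimately have "p ^ n dvd k * p" by (simp add: coprime_dvd_mult_left_iff)
    hence "d [^] p = \<one>" using k a n by (simp add: nat_pow_pow pow_eq_id)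
    thus ?thesis using d(1) by (simp add: Z_def)
  qed
  have r1: "[r = 1] (mod p)"
    by (rule twisted_exponent_cong_one[OF p(1) a a1 n y ya ypa])
  have yZ: "y \<otimes> c = c \<otimes> y" if c: "c \<in> Z" for c
  proof -
    have cA: "c \<in> A" and cp: "c [^] p = \<one>" using c by (auto simp: Z_def)
    obtain k :: nat where k: "c = a [^] k" using cA A_eq by blast
    have "y \<otimes> c = c [^] r \<otimes> y"
      using twisted_commute_pow[OF y a _ ya] k a by (simp add: nat_pow_pow mult.commute)
    moreover have "ord c dvd p" using cp cA by (simp add: pow_eq_id)
    hence "c [^] r = c [^] (1::nat)"
      using r1 cA by (intro pow_cong_ord) (auto intro: cong_dvd_modulus_nat)
    ultimately show ?thesis using cA by simp
  qed
  \<comment> \<open>Conjugates of \<open>y\<close> lie in \<open>A y\<close> because \<open>y\<close>, like \<open>x\<close>, is central modulo \<open>A\<close>; having trivial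
    \<open>p\<close>-th power confines them to \<open>Z y\<close>.\<close>
  have yconj: "\<exists>c\<in>Z. g \<otimes> y \<otimes> inv g = c \<otimes> y" if g: "g \<in> carrier G" for g
  proof -
    interpret c: group_hom G G "\<lambda>h. g \<otimes> h \<otimes> inv g"
      by (rule conjugation_endomorphism[OF g])
    obtain h where h: "h \<in> A" "g \<otimes> x \<otimes> inv g = h \<otimes> x" using x(4)[OF g] by blast
    define b where "b = g \<otimes> a [^] j \<otimes> inv g"
    have b: "b \<in> A" using A.inv_op_closed2[OF g ajA] by (simp add: b_def)
    let ?d = "b \<otimes> h \<otimes> inv (a [^] j)"
    have d: "?d \<in> A" using b h ajA by blast
    have "g \<otimes> y \<otimes> inv g = b \<otimes> (h \<otimes> x)"
      using c.hom_mult[of "a [^] j" x] a x(1) h(2) by (simp add: y_def b_def)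
    also have "h \<otimes> x = h \<otimes> (inv (a [^] j) \<otimes> y)"
      using a x(1) by (simp add: y_def m_assoc[symmetric])
    finally have eq: "g \<otimes> y \<otimes> inv g = ?d \<otimes> y"
      using b h a y by (simp add: m_assoc)
    have "(g \<otimes> y \<otimes> inv g) [^] p = \<one>"
      using c.hom_nat_pow[OF y, of p] yp g by simp
    thus ?thesis using eq torsion[OF d] by metis
  qed
  have n0: "n \<noteq> 0" using n a a1 ord_eq_1 by (metis power_0)
  define z where "z = a [^] (p ^ (n - 1))"
  have "z [^] p = \<one>"
    using a n n0 by (simp add: z_def nat_pow_pow pow_eq_id power_minus_mult flip: One_nat_def)
  moreover have "z \<in> A" using A_eq by (auto simp: z_def)
  ultimately have zZ: "z \<in> Z" by (simp add: Z_def)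
  have z1: "z \<noteq> \<one>"
    using a n n0 prime_gt_1_nat[OF p(1)] by (simp add: z_def pow_eq_id dvd_power_iff_le)
  have "y \<notin> Z" using yA by (simp add: Z_def)
  note ext = normal_abelian_extension[OF ZN y yZ yconj]
  have "\<not> cyclic_group (G\<lparr>carrier := Z <#> generate G {y}\<rparr>)"
    using elementary_extension_not_cyclic[OF p(1) fin normal_imp_subgroup[OF ZN(1)] _ zZ z1 y yp
        \<open>y \<notin> Z\<close> normal_imp_subgroup[OF ext(1)] ext(2-4)]
    by (simp add: Z_def)
  thus ?thesis using ext by blast
qed

end

section \<open>Groups whose normal abelian subgroups are cyclic\<close>

theorem theorem3:
  fixes p :: nat and G :: "('a, 'b) monoid_scheme"
  assumes "Factorial_Ring.prime p" and "odd p"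
    and "finite_p_group p G"
    and "\<And>N. N \<lhd> G \<Longrightarrow> comm_group (G\<lparr>carrier := N\<rparr>) \<Longrightarrow> cyclic_group (G\<lparr>carrier := N\<rparr>)"
  shows "cyclic_group G"
proof -
  interpret group G using assms(3) by (simp add: finite_p_group_def)
  have fin: "finite (carrier G)" using assms(3) by (simp add: finite_p_group_def)
  define \<A> where "\<A> = {N. N \<lhd> G \<and> comm_group (G\<lparr>carrier := N\<rparr>)}"
  have sub: "\<A> \<subseteq> Pow (carrier G)"
    unfolding \<A>_def using normal_imp_subgroup subgroup.subset by blast
  have "finite \<A>" using sub fin by (meson finite_Pow_iff finite_subset)
  moreover have "{\<one>\<^bsub>G\<^esub>} \<in> \<A>"
    unfolding \<A>_def using one_is_normal comm_subgroup_iff[OF triv_subgroup] by simp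
  ultimately obtain A where A: "A \<in> \<A>" and max: "\<And>N. N \<in> \<A> \<Longrightarrow> A \<subseteq> N \<Longrightarrow> A = N"
    using finite_has_maximal[of \<A>] by (metis empty_iff)
  have AN: "A \<lhd> G" "comm_group (G\<lparr>carrier := A\<rparr>)" using A by (auto simp: \<A>_def)
  have cycA: "cyclic_group (G\<lparr>carrier := A\<rparr>)" using assms(4) AN by blast
  have "A = carrier G"
  proof (rule ccontr)
    assume "A \<noteq> carrier G"
    then obtain M where "M \<lhd> G" "comm_group (G\<lparr>carrier := M\<rparr>)" "\<not> cyclic_group (G\<lparr>carrier := M\<rparr>)"
      using noncyclic_normal_abelian_subgroup[OF assms(1-3) AN cycA] max by (auto simp: \<A>_def)
    thus False using assms(4) by blast
  qed
  thus ?thesis using cycA by simp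
qed

end
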